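(* Let $C=\bigcup_{m=1}^M C_m$ where each $C_m\subset\mathbb{R}^n$ ($1\le m\le M$) is a closed convex set. Fix $\theta^*\in C$ and $z\in\mathbb{R}^n$, and let $y=\theta^*+z$. Define $f_{\theta^*}:[0,\infty)\to\mathbb{R}$ by $$f_{\theta^*}(t)=\sup_{\theta\in C:\ \|\theta-\theta^*\|\le t}\langle z,\theta-\theta^*\rangle-\frac{t^2}{2}.$$ Let $\hat\theta\in\arg\min_{\theta\in C}\|y-\theta\|^2$ be any least squares estimator over $C$. Then $$\|\hat\theta-\theta^*\|\in\arg\max_{t\ge0}f_{\theta^*}(t).$$ Moreover, if $t^*\ge 0$ satisfies $f_{\theta^*}(t)<0$ for all $t\ge t^*$, then $$\|\hat\theta-\theta^*\|<t^*.$$ (Both statements are deterministic: they hold for every $z\in\mathbb{R}^n$.)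
   Context: $\|\cdot\|$ and $\langle\cdot,\cdot\rangle$ are the Euclidean norm and inner product on $\mathbb{R}^n$. $\arg\max$ and $\arg\min$ denote the sets of all maximizers and minimizers, respectively. *)

theory Defs
  imports "HOL-Analysis.Analysis"
begin

(* The function f_{thetas} of the constraint set C, the point thetas and the noise z.
   Its intended domain is t >= 0; for thetas in C the supremum is then over a nonempty
   bounded set of reals, so the real-valued SUP is the genuine supremum. For t < 0 the
   index set is empty and the value is meaningless. *)
definition lse_objective ::
  "(real ^ 'n) set \<Rightarrow> real ^ 'n \<Rightarrow> real ^ 'n \<Rightarrow> real \<Rightarrow> real" where
  "lse_objective C thetas z t =
     (SUP \<theta>\<in>{\<theta> \<in> C. norm (\<theta> - thetas) \<le> t}. z \<bullet> (\<theta> - thetas)) - t\<^sup>2 / 2"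

end

theory Submission
  imports Defs
begin

text \<open>
  Put \<open>g \<theta> = z \<bullet> (\<theta> - thetas) - (norm (\<theta> - thetas))\<^sup>2 / 2\<close>. Expanding the square,
  \<open>(norm (thetas + z - \<theta>))\<^sup>2 = (norm z)\<^sup>2 - 2 * g \<theta>\<close>, so least squares estimators are exactly the
  maximizers of \<open>g\<close> over \<open>C\<close>. The maximum of \<open>g\<close> dominates the objective at every radius \<open>t\<close>, because
  \<open>norm (\<theta> - thetas) \<le> t\<close> on the set under the supremum; and it is attained by the objective at the
  radius of the estimator. The maximum is nonnegative since \<open>g thetas = 0\<close>.
\<close>

lemma lse_objective_ge:
  assumes "\<theta> \<in> C"
  shows "z \<bullet> (\<theta> - thetas) - (norm (\<theta> - thetas))\<^sup>2 / 2
    \<le> lse_objective C thetas z (norm (\<theta> - thetas))"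
proof -
  let ?S = "{\<eta> \<in> C. norm (\<eta> - thetas) \<le> norm (\<theta> - thetas)}"
  \<comment> \<open>Cauchy-Schwarz supplies boundedness: a real \<open>SUP\<close> is known to
    dominate its members only when they are bounded above.\<close>
  have "z \<bullet> (\<eta> - thetas) \<le> norm z * norm (\<theta> - thetas)" if "\<eta> \<in> ?S" for \<eta>
    using norm_cauchy_schwarz[of z "\<eta> - thetas"] that
      mult_left_mono[of "norm (\<eta> - thetas)" "norm (\<theta> - thetas)" "norm z"] by auto
  then have "bdd_above ((\<lambda>\<eta>. z \<bullet> (\<eta> - thetas)) ` ?S)"
    by (rule bdd_aboveI2)
  then have "z \<bullet> (\<theta> - thetas) \<le> (SUP \<eta>\<in>?S. z \<bullet> (\<eta> - thetas))"
    using assms by (intro cSUP_upper) auto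
  then show ?thesis
    by (simp add: lse_objective_def)
qed

lemma lse_objective_le:
  assumes "thetas \<in> C" and "t \<ge> 0"
    and bound: "\<And>\<theta>. \<theta> \<in> C \<Longrightarrow> z \<bullet> (\<theta> - thetas) - (norm (\<theta> - thetas))\<^sup>2 / 2 \<le> b"
  shows "lse_objective C thetas z t \<le> b"
proof -
  let ?S = "{\<theta> \<in> C. norm (\<theta> - thetas) \<le> t}"
  have "(SUP \<theta>\<in>?S. z \<bullet> (\<theta> - thetas)) \<le> b + t\<^sup>2 / 2"
  proof (rule cSUP_least)
    \<comment> \<open>The witness is \<open>thetas\<close>, at distance 0 from itself; this is where
      \<open>t \<ge> 0\<close> enters.\<close>
    show "?S \<noteq> {}"
      using assms(1,2) by force
  next
    fix \<theta> assume \<theta>: "\<theta> \<in> ?S"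
    then have "(norm (\<theta> - thetas))\<^sup>2 \<le> t\<^sup>2"
      by (intro power_mono) auto
    then show "z \<bullet> (\<theta> - thetas) \<le> b + t\<^sup>2 / 2"
      using bound[of \<theta>] \<theta> by auto
  qed
  then show ?thesis
    by (simp add: lse_objective_def)
qed

theorem lemma3p1:
  fixes K :: "nat \<Rightarrow> (real ^ 'n) set" and M :: nat
    and C :: "(real ^ 'n) set"
    and thetas z y thetahat :: "real ^ 'n"
  assumes closed_convex: "\<And>m. m \<in> {1..M} \<Longrightarrow> closed (K m) \<and> convex (K m)"
    and C_union: "C = (\<Union>m\<in>{1..M}. K m)"
    and thetas_in: "thetas \<in> C"
    and y_eq: "y = thetas + z"
    and lse: "is_arg_min (\<lambda>\<theta>. (norm (y - \<theta>))\<^sup>2) (\<lambda>\<theta>. \<theta> \<in> C) thetahat"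
  shows "is_arg_max (lse_objective C thetas z) (\<lambda>t. t \<ge> 0) (norm (thetahat - thetas)) \<and>
    (\<forall>tstar\<ge>0. (\<forall>t\<ge>tstar. lse_objective C thetas z t < 0) \<longrightarrow>
       norm (thetahat - thetas) < tstar)"
proof -
  define g where "g \<theta> = z \<bullet> (\<theta> - thetas) - (norm (\<theta> - thetas))\<^sup>2 / 2" for \<theta>
  let ?r = "norm (thetahat - thetas)"
  have expand: "(norm (y - \<theta>))\<^sup>2 = (norm z)\<^sup>2 - 2 * g \<theta>" for \<theta>
    using dot_norm_neg[of z "\<theta> - thetas"] by (simp add: g_def y_eq algebra_simps)
  have hat_in: "thetahat \<in> C" and g_le: "\<And>\<theta>. \<theta> \<in> C \<Longrightarrow> g \<theta> \<le> g thetahat"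
    using lse by (auto simp: is_arg_min_linorder expand)
  have upper: "lse_objective C thetas z t \<le> g thetahat" if "t \<ge> 0" for t
    using thetas_in that g_le unfolding g_def by (rule lse_objective_le)
  have lower: "g thetahat \<le> lse_objective C thetas z ?r"
    unfolding g_def using hat_in by (rule lse_objective_ge)
  have "0 \<le> lse_objective C thetas z ?r"
    using g_le[OF thetas_in] lower by (simp add: g_def)
  moreover have "is_arg_max (lse_objective C thetas z) (\<lambda>t. t \<ge> 0) ?r"
    using upper lower by (fastforce simp: is_arg_max_linorder)
  \<comment> \<open>If \<open>tstar \<le> ?r\<close>, the hypothesis on \<open>tstar\<close> would
    make the objective negative at \<open>?r\<close>, where it is nonnegative.\<close>
  ultimately show ?thesis
    by (meson not_le)
qed

end
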